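(* Let $d\ge 2$ and $s\ge 3$ be integers and let $G$ be a $\{K_{1,d},P_s\}$-free graph. Then $\mathsf{tree}\text{-}\alpha(G)\le (d-1)(s-2)$.
   Context: Graphs are finite and simple; $G$ is $\{H_1,H_2\}$-free if it has no induced subgraph isomorphic to $H_1$ or $H_2$. $K_{1,d}$ is the star with $d$ leaves and $P_s$ is the path on $s$ vertices. A tree decomposition of $G$ is a pair $(T,\beta)$ with $T$ a tree and $\beta:V(T)\to 2^{V(G)}$ such that every vertex lies in some bag, every edge has both endpoints in some bag, and for each vertex the nodes whose bags contain it induce a subtree. Its independence number is $\max_t \alpha(G[\beta(t)])$; $\mathsf{tree}\text{-}\alpha(G)$ is the minimum independence number over all tree decompositions of $G$. *)

theory Defs
  imports
    "Graph_Theory.Digraph_Isomorphism"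
    "Graph_Theory.Kuratowski"
begin

text \<open>Finite simple graphs are the library's \<^locale>\<open>graph\<close>s, that is, finite loop-free symmetric
  digraphs without parallel arcs; an edge is a pair of opposite arcs.\<close>

definition star_graph :: "nat \<Rightarrow> nat pair_pre_digraph" where
  "star_graph d = \<lparr>pverts = {0..d}, parcs = {0} \<times> {1..d} \<union> {1..d} \<times> {0}\<rparr>"

definition path_graph :: "nat \<Rightarrow> nat pair_pre_digraph" where
  "path_graph s = \<lparr>pverts = {..<s},
     parcs = {(i, j). i < s \<and> j < s \<and> (j = Suc i \<or> i = Suc j)}\<rparr>"

lemma star_graph_complete_bipartite: "K\<^bsub>1,d\<^esub> (with_proj (star_graph d))"
  unfolding complete_bipartite_digraph_pair_def
proof (rule conjI)
  show "finite (pverts (star_graph d))"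
    by (simp add: star_graph_def)
  have "pverts (star_graph d) = {0} \<union> {1..d} \<and> {0} \<inter> {1..d} = {} \<and> card {0::nat} = 1 \<and>
      card {1..d} = d \<and> parcs (star_graph d) = {0} \<times> {1..d} \<union> {1..d} \<times> {0}"
    by (auto simp: star_graph_def)
  then show "\<exists>U V. pverts (star_graph d) = U \<union> V \<and> U \<inter> V = {} \<and> card U = 1 \<and> card V = d \<and>
      parcs (star_graph d) = U \<times> V \<union> V \<times> U"
    by - (rule exI[of _ "{0}"], rule exI[of _ "{1..d}"])
qed

definition induced_free :: "('a, 'b) pre_digraph \<Rightarrow> ('c, 'd) pre_digraph \<Rightarrow> bool" where
  "induced_free G H \<longleftrightarrow> \<not> (\<exists>G'. induced_subgraph G' G \<and> digraph_iso G' H)"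

definition independent_set :: "('a, 'b) pre_digraph \<Rightarrow> 'a set \<Rightarrow> bool" where
  "independent_set G S \<longleftrightarrow> S \<subseteq> verts G \<and> (\<forall>u\<in>S. \<forall>v\<in>S. (u, v) \<notin> arcs_ends G)"

definition independence_number :: "('a, 'b) pre_digraph \<Rightarrow> nat" where
  "independence_number G = Max (card ` {S. independent_set G S})"

text \<open>The library's \<^const>\<open>tree\<close> is not usable here: in a symmetric digraph every edge
  yields a directed cycle of length two. The cycles of a simple undirected graph are exactly the
  directed cycles of length at least three of its symmetric digraph. Note that
  \<^const>\<open>Digraph_Component.connected\<close> requires a nonempty vertex set.\<close>

definition undirected_tree :: "('a, 'b) pre_digraph \<Rightarrow> bool" where
  "undirected_tree T \<longleftrightarrow> graph T \<and> Digraph_Component.connected T \<and>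
     \<not> (\<exists>p. pre_digraph.cycle T p \<and> 3 \<le> length p)"

definition tree_decomposition ::
    "('a, 'b) pre_digraph \<Rightarrow> ('t, 'e) pre_digraph \<Rightarrow> ('t \<Rightarrow> 'a set) \<Rightarrow> bool" where
  "tree_decomposition G T \<beta> \<longleftrightarrow>
     undirected_tree T \<and>
     (\<forall>t\<in>verts T. \<beta> t \<subseteq> verts G) \<and>
     (\<forall>v\<in>verts G. \<exists>t\<in>verts T. v \<in> \<beta> t) \<and>
     (\<forall>e\<in>arcs G. \<exists>t\<in>verts T. tail G e \<in> \<beta> t \<and> head G e \<in> \<beta> t) \<and>
     (\<forall>v\<in>verts G. undirected_tree (T \<restriction> {t\<in>verts T. v \<in> \<beta> t}))"

definition decomposition_independence_number ::
    "('a, 'b) pre_digraph \<Rightarrow> ('t, 'e) pre_digraph \<Rightarrow> ('t \<Rightarrow> 'a set) \<Rightarrow> nat" where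
  "decomposition_independence_number G T \<beta> =
     Max ((\<lambda>t. independence_number (G \<restriction> \<beta> t)) ` verts T)"

text \<open>Every finite tree is isomorphic to one whose nodes are natural numbers, so it suffices
  to let the decomposition trees range over these. The minimum below is over a nonempty set, as
  the trivial decomposition shows.\<close>

definition tree_alpha :: "('a, 'b) pre_digraph \<Rightarrow> nat" where
  "tree_alpha G = (LEAST k. \<exists>(T :: nat pair_pre_digraph) \<beta>.
     tree_decomposition G (with_proj T) \<beta> \<and>
     k = decomposition_independence_number G (with_proj T) \<beta>)"

lemma undirected_tree_single_node:
  assumes T: "verts T = {t}" "arcs T = {}"
  shows "undirected_tree T"
proof -
  have "graph T"
    using T by unfold_locales (auto simp: symmetric_def arcs_ends_def sym_def)
  moreover have "Digraph_Component.connected T"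
    using T by (auto simp: connected_def strongly_connected_def mk_symmetric_def reachable_def
        intro: rtrancl_on.intros)
  moreover have "\<not> pre_digraph.cycle T p" for p
    using T by (auto simp: pre_digraph.cycle_def pre_digraph.awalk_def)
  ultimately show ?thesis
    by (simp add: undirected_tree_def)
qed

lemma trivial_tree_decomposition:
  assumes "wf_digraph G"
  shows "tree_decomposition G (with_proj \<lparr>pverts = {t}, parcs = {}\<rparr>) (\<lambda>_. verts G)"
    (is "tree_decomposition G ?T _")
proof -
  have "undirected_tree ?T"
    by (rule undirected_tree_single_node) simp_all
  moreover have "undirected_tree (?T \<restriction> {t' \<in> verts ?T. v \<in> verts G})" if "v \<in> verts G" for v
    using that by (intro undirected_tree_single_node) simp_all
  ultimately show ?thesis
    using wf_digraph.tail_in_verts[OF assms] wf_digraph.head_in_verts[OF assms]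
    unfolding tree_decomposition_def by simp
qed

lemma tree_alpha_attained:
  assumes "wf_digraph G"
  obtains T :: "nat pair_pre_digraph" and \<beta> where
    "tree_decomposition G (with_proj T) \<beta>"
    "tree_alpha G = decomposition_independence_number G (with_proj T) \<beta>"
proof -
  let ?P = "\<lambda>k. \<exists>(T :: nat pair_pre_digraph) \<beta>. tree_decomposition G (with_proj T) \<beta> \<and>
      k = decomposition_independence_number G (with_proj T) \<beta>"
  have "?P (decomposition_independence_number G
      (with_proj \<lparr>pverts = {0::nat}, parcs = {}\<rparr>) (\<lambda>_. verts G))"
    by (intro exI conjI, rule trivial_tree_decomposition[OF assms], rule refl)
  then have "?P (tree_alpha G)"
    unfolding tree_alpha_def by (rule LeastI)
  then show ?thesis
    by (elim exE conjE) (rule that)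
qed

end

theory Submission
  imports Defs
begin

text \<open>The Gyarfas path argument, turned into a tree decomposition. Process the vertices in rounds; let
  \<open>U\<close> be the set of processed vertices. Each component \<open>C\<close> of \<open>G - U\<close> that has neighbours in \<open>U\<close> is
  accompanied by an induced path \<open>v\<^sub>1, \<dots>, v\<^sub>k\<close> whose closed neighbourhood contains \<open>N(C)\<close>, where
  only \<open>v\<^sub>k\<close> has neighbours in \<open>C\<close>. The next bag is \<open>N(C) \<union> (N(v\<^sub>k) \<inter> C)\<close>, attached below a bag
  containing \<open>N(C)\<close>. Every component of what remains of \<open>C\<close> is attached to some
  \<open>w \<in> N(v\<^sub>k) \<inter> C\<close>, which prolongs the path. If \<open>N(C)\<close> is empty, the bag is a single vertex of \<open>C\<close>.
  As \<open>v\<^sub>1, \<dots>, v\<^sub>k, w\<close> is an induced path, \<open>k \<le> s - 2\<close>. An independent subset of a closed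
  neighbourhood \<open>N[v]\<close> has at most \<open>d - 1\<close> elements, so each bag, being covered by \<open>k\<close> such
  neighbourhoods, has independence number at most \<open>(d - 1)(s - 2)\<close>.\<close>

section \<open>Trees given by a parent function\<close>

text \<open>The value \<open>p i\<close> counts as a parent only if \<open>p i < i\<close>; otherwise \<open>i\<close> is a root.\<close>

definition parent_tree :: "(nat \<Rightarrow> nat) \<Rightarrow> nat set \<Rightarrow> nat pair_pre_digraph" where
  "parent_tree p X = \<lparr>pverts = X,
     parcs = {(i, j). i \<in> X \<and> j \<in> X \<and> (j < i \<and> j = p i \<or> i < j \<and> i = p j)}\<rparr>"

lemma pverts_parent_tree [simp]: "pverts (parent_tree p X) = X"
  and parcs_parent_tree: "(i, j) \<in> parcs (parent_tree p X) \<longleftrightarrow>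
    i \<in> X \<and> j \<in> X \<and> (j < i \<and> j = p i \<or> i < j \<and> i = p j)"
  by (auto simp: parent_tree_def)

text \<open>Induced subgraphs keep the parent function, so the bags of a single vertex can be shown
  to form a subtree by the same criterion as the whole tree.\<close>

lemma induce_subgraph_parent_tree:
  assumes "Y \<subseteq> X"
  shows "with_proj (parent_tree p X) \<restriction> Y = with_proj (parent_tree p Y)"
  using assms by (auto simp: induce_subgraph_def with_proj_def parent_tree_def)

lemma graph_parent_tree:
  assumes "finite X"
  shows "graph (with_proj (parent_tree p X))"
proof -
  have "parcs (parent_tree p X) \<subseteq> X \<times> X"
    by (auto simp: parent_tree_def)
  then have "finite (parcs (parent_tree p X))"
    using assms finite_subset by blast
  then show ?thesis
    using assms
    by unfold_locales (auto simp: parcs_parent_tree arc_to_ends_def symmetric_def arcs_ends_def sym_def)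
qed

text \<open>Parents strictly decrease, so climbing ends at \<open>r\<close>; any two nodes are
  joined through \<open>r\<close> because the arcs are symmetric.\<close>

lemma connected_parent_tree:
  assumes "finite X" "r \<in> X" and parent: "\<And>i. i \<in> X \<Longrightarrow> i \<noteq> r \<Longrightarrow> p i \<in> X \<and> p i < i"
  shows "Digraph_Component.connected (with_proj (parent_tree p X))"
proof -
  interpret graph "with_proj (parent_tree p X)"
    by (rule graph_parent_tree) fact
  let ?T = "with_proj (parent_tree p X)"
  have dom: "(i, j) \<in> arcs_ends ?T \<longleftrightarrow> (i, j) \<in> parcs (parent_tree p X)" for i j
    by (force simp: arcs_ends_def arc_to_ends_def)
  have root: "i \<in> X \<Longrightarrow> i \<rightarrow>\<^sup>*\<^bsub>?T\<^esub> r" for i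
  proof (induction i rule: less_induct)
    case (less i)
    show ?case
    proof (cases "i = r")
      case False
      then have "(i, p i) \<in> arcs_ends ?T"
        using less.prems parent by (simp add: dom parcs_parent_tree)
      then show ?thesis
        using less False parent by (meson adj_reachable_trans)
    qed (use less.prems in simp)
  qed
  have "u \<rightarrow>\<^sup>*\<^bsub>?T\<^esub> v" if "u \<in> X" "v \<in> X" for u v
    using that root symmetric_reachable[OF sym_arcs] reachable_trans by blast
  then show ?thesis
    using \<open>r \<in> X\<close> unfolding connected_def strongly_connected_def
    by (auto simp: reachable_mk_symmetric_eq[OF sym_arcs])
qed

lemma (in pre_digraph) cas_nth_Suc:
  "cas u q v \<Longrightarrow> Suc k < length q \<Longrightarrow> tail G (q ! Suc k) = head G (q ! k)"
proof (induction q arbitrary: u k)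
  case (Cons e q)
  then show ?case
    by (cases k; cases q) auto
qed simp

lemma (in pre_digraph) cas_head_last:
  "cas u q v \<Longrightarrow> q \<noteq> [] \<Longrightarrow> head G (last q) = v"
  by (induction q arbitrary: u) auto

lemma (in pre_digraph) cas_closed_nth:
  assumes "cas u q u" "k < length q"
  shows "tail G (q ! (Suc k mod length q)) = head G (q ! k)"
proof (cases "Suc k < length q")
  case False
  then have "Suc k = length q" "q \<noteq> []"
    using assms by auto
  moreover have "tail G (hd q) = u"
    using assms(1) \<open>q \<noteq> []\<close> by (cases q) auto
  moreover have "head G (last q) = u"
    using cas_head_last assms(1) \<open>q \<noteq> []\<close> .
  ultimately show ?thesis
    by (metis diff_Suc_1 hd_conv_nth last_conv_nth mod_self)
qed (use cas_nth_Suc[OF assms(1)] in simp)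

text \<open>The largest vertex on a cycle would have its parent as both its predecessor and its
  successor.\<close>

lemma acyclic_parent_tree:
  assumes "pre_digraph.cycle (with_proj (parent_tree p X)) q" "3 \<le> length q"
  shows False
proof -
  let ?T = "with_proj (parent_tree p X)"
  let ?L = "length q"
  obtain u where u: "pre_digraph.awalk ?T u q u" "distinct (tl (pre_digraph.awalk_verts ?T u q))"
      "q \<noteq> []"
    using assms(1) by (auto simp: pre_digraph.cycle_def)
  then have cas: "pre_digraph.cas ?T u q u" and arcs: "set q \<subseteq> parcs (parent_tree p X)"
    by (auto simp: pre_digraph.awalk_def)
  have dist: "distinct (map snd q)"
    using u(2,3) pre_digraph.awalk_verts_conv'[OF cas] by simp
  have next_arc: "fst (q ! (Suc k mod ?L)) = snd (q ! k)" if "k < ?L" for k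
    using pre_digraph.cas_closed_nth[OF cas that] by simp
  define m where "m = Max (set (map snd q))"
  have "m \<in> set (map snd q)"
    unfolding m_def using u(3) by (intro Max_in) auto
  then obtain k where k: "k < ?L" "snd (q ! k) = m"
    by (auto simp: in_set_conv_nth)
  have le: "snd (q ! l) \<le> m" if "l < ?L" for l
    unfolding m_def using that by (intro Max_ge) auto
  define k' where "k' = (if k = 0 then ?L - 1 else k - 1)"
  have k': "k' < ?L" "Suc k' mod ?L = k"
    using k(1) by (auto simp: k'_def)
  define k'' where "k'' = Suc k mod ?L"
  \<comment> \<open>With only two arcs the positions before and after \<open>k\<close> would
    coincide; length at least 3 keeps them apart.\<close>
  have k'': "k'' < ?L" "k'' \<noteq> k'"
    using k(1) assms(2) by (auto simp: k''_def k'_def mod_Suc)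
  have arc: "q ! l \<in> parcs (parent_tree p X)" if "l < ?L" for l
    using arcs that by auto
  have "q ! k = (snd (q ! k'), m)" "q ! k'' = (m, snd (q ! k''))"
    using next_arc[OF k'(1)] next_arc[OF k(1)] k k' by (simp_all add: prod_eq_iff k''_def)
  then have "(snd (q ! k'), m) \<in> parcs (parent_tree p X)"
      "(m, snd (q ! k'')) \<in> parcs (parent_tree p X)"
    using arc[OF k(1)] arc[OF k''(1)] by simp_all
  then have "snd (q ! k') = p m" "snd (q ! k'') = p m"
    using le[OF k'(1)] le[OF k''(1)] by (simp_all add: parcs_parent_tree)
  then show False
    using nth_eq_iff_index_eq[OF dist, of k' k''] k'(1) k'' by simp
qed

lemma undirected_tree_parent_tree:
  assumes "finite X" "r \<in> X" "\<And>i. i \<in> X \<Longrightarrow> i \<noteq> r \<Longrightarrow> p i \<in> X \<and> p i < i"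
  shows "undirected_tree (with_proj (parent_tree p X))"
  using graph_parent_tree[OF assms(1)] connected_parent_tree[OF assms] acyclic_parent_tree
  by (auto simp: undirected_tree_def)

section \<open>Forbidden induced subgraphs and independent sets\<close>

text \<open>The inverse of \<open>g\<close> yields the isomorphism: an arc goes to the pair of
  preimages of its ends, which is injective on arcs as there are no parallel ones.\<close>

lemma not_induced_freeI:
  assumes "graph G" and "g ` pverts H \<subseteq> verts G" and inj: "inj_on g (pverts H)"
    and H: "parcs H \<subseteq> pverts H \<times> pverts H"
    and adj: "\<And>i j. i \<in> pverts H \<Longrightarrow> j \<in> pverts H \<Longrightarrow> (g i, g j) \<in> arcs_ends G \<longleftrightarrow> (i, j) \<in> parcs H"
  shows "\<not> induced_free G (with_proj H)"
proof -
  interpret graph G by fact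
  let ?S = "g ` pverts H"
  let ?G = "G \<restriction> ?S"
  define f where "f = the_inv_into (pverts H) g"
  define h where "h = (\<lambda>a. (f (tail G a), f (head G a)))"
  have f: "f (g i) = i" if "i \<in> pverts H" for i
    using that inj by (simp add: f_def the_inv_into_f_f)
  have f_img: "f ` ?S = pverts H"
    using f by (auto simp: image_image)
  have "inj_on f ?S"
    using f by (auto simp: inj_on_def)
  have inj_h: "inj_on h (arcs ?G)"
  proof (rule inj_onI)
    fix a b assume ab: "a \<in> arcs ?G" "b \<in> arcs ?G" "h a = h b"
    then have "arc_to_ends G a = arc_to_ends G b"
      using \<open>inj_on f ?S\<close> by (auto simp: h_def arc_to_ends_def inj_on_eq_iff)
    then show "a = b"
      using ab no_multi_arcs by auto
  qed
  have h_img: "h ` arcs ?G = parcs H"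
  proof (rule set_eqI, clarify)
    fix i j
    show "(i, j) \<in> h ` arcs ?G \<longleftrightarrow> (i, j) \<in> parcs H"
    proof
      assume "(i, j) \<in> h ` arcs ?G"
      then obtain a where "(i, j) = h a" "a \<in> arcs ?G"
        by (rule imageE)
      then have a: "a \<in> arcs G" "tail G a \<in> ?S" "head G a \<in> ?S" "(i, j) = h a"
        by simp_all
      obtain i' where i': "tail G a = g i'" "i' \<in> pverts H"
        using a(2) by (rule imageE)
      obtain j' where j': "head G a = g j'" "j' \<in> pverts H"
        using a(3) by (rule imageE)
      note ij = i'(1) j'(1) i'(2) j'(2)
      have "(tail G a, head G a) \<in> arcs_ends G"
        using a(1) by (simp add: arcs_ends_conv)
      then have "(g i', g j') \<in> arcs_ends G"
        using ij by simp
      then show "(i, j) \<in> parcs H"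
        using a(4) ij f adj by (simp add: h_def)
    next
      assume ij: "(i, j) \<in> parcs H"
      then have mem: "i \<in> pverts H" "j \<in> pverts H"
        using H by auto
      then obtain a where "a \<in> arcs G" "tail G a = g i" "head G a = g j"
        using ij adj by blast
      then show "(i, j) \<in> h ` arcs ?G"
        using mem f by (auto simp: h_def intro!: image_eqI[of _ _ a])
    qed
  qed
  define iso where "iso = \<lparr>iso_verts = f, iso_arcs = h, iso_head = snd, iso_tail = fst\<rparr>"
  have "pre_digraph.digraph_isomorphism ?G iso"
    using inj_h \<open>inj_on f ?S\<close> wellformed_induce_subgraph
    by (simp add: pre_digraph.digraph_isomorphism_def iso_def h_def)
  moreover have "with_proj H = app_iso iso ?G"
    unfolding app_iso_def iso_def using f_img h_img
    by (simp add: with_proj_def del: induce_subgraph_arcs)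
  ultimately have "digraph_iso ?G (with_proj H)"
    unfolding digraph_iso_def by blast
  then show ?thesis
    using induced_induce[OF assms(2)] by (auto simp: induced_free_def)
qed

definition closed_nbhd :: "('a, 'b) pre_digraph \<Rightarrow> 'a set \<Rightarrow> 'a set" where
  "closed_nbhd G A = A \<union> {u. \<exists>v\<in>A. (v, u) \<in> arcs_ends G}"

text \<open>Otherwise \<open>d\<close> vertices of \<open>S\<close> would be the leaves of an
  induced star centred at \<open>v\<close>.\<close>

lemma card_independent_closed_nbhd_le:
  assumes G: "graph G" and free: "induced_free G (with_proj (star_graph d))" and "2 \<le> d"
    and S: "independent_set G S" "S \<subseteq> closed_nbhd G {v}"
  shows "card S \<le> d - 1"
proof (rule ccontr)
  interpret graph G by fact
  assume "\<not> ?thesis"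
  then have "d \<le> card S"
    by simp
  then obtain L where L: "L \<subseteq> S" "card L = d" "finite L"
    by (meson obtain_subset_with_card_n)
  then have sub: "L \<subseteq> verts G" and ind: "u \<in> L \<Longrightarrow> w \<in> L \<Longrightarrow> (u, w) \<notin> arcs_ends G" for u w
    using S(1) by (auto simp: independent_set_def)
  have "L \<subseteq> {v} \<union> {u. (v, u) \<in> arcs_ends G}"
    using S(2) L(1) by (auto simp: closed_nbhd_def)
  \<comment> \<open>As \<open>d\<close> is at least 2, \<open>L\<close> contains a neighbour of
    \<open>v\<close>; independence then keeps \<open>v\<close> itself out of
    \<open>L\<close>.\<close>
  moreover have "\<not> L \<subseteq> {v}"
    using \<open>2 \<le> d\<close> L(2) card_mono[of "{v}" L] by auto
  ultimately have v: "v \<notin> L" and adj: "u \<in> L \<Longrightarrow> (v, u) \<in> arcs_ends G" for u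
    using ind by blast+
  have "L \<noteq> {}"
    using L(2) \<open>2 \<le> d\<close> by auto
  then obtain u where "(v, u) \<in> arcs_ends G"
    using adj by blast
  then have "v \<in> verts G"
    by auto
  obtain h where h: "bij_betw h {1..d} L"
    using ex_bij_betw_nat_finite_1[OF \<open>finite L\<close>] L(2) by auto
  define g where "g i = (if i = 0 then v else h i)" for i :: nat
  have gL: "g i \<in> L" if "i \<in> {1..d}" for i
    using that bij_betwE[OF h] by (simp add: g_def)
  have verts: "pverts (star_graph d) = insert 0 {1..d}"
    by (auto simp: star_graph_def)
  have "inj_on g {1..d}"
    using bij_betw_imp_inj_on[OF h] by (subst inj_on_cong[of _ _ h]) (auto simp: g_def)
  then have "inj_on g (pverts (star_graph d))"
    unfolding verts using gL v by (auto simp: g_def[of 0])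
  moreover have "g ` pverts (star_graph d) \<subseteq> verts G"
    unfolding verts using gL sub \<open>v \<in> verts G\<close> by (auto simp: g_def[of 0])
  moreover have "(g i, g j) \<in> arcs_ends G \<longleftrightarrow> (i, j) \<in> parcs (star_graph d)"
    if "i \<in> pverts (star_graph d)" "j \<in> pverts (star_graph d)" for i j
  proof -
    have "(v, v) \<notin> arcs_ends G"
      using adj_not_same by blast
    moreover have "(u, v) \<in> arcs_ends G" if "u \<in> L" for u
      using adj[OF that] arcs_ends_symmetric[OF sym_arcs] by blast
    ultimately show ?thesis
      using that gL[of i] gL[of j] adj ind
      by (cases "i = 0"; cases "j = 0") (auto simp: star_graph_def g_def)
  qed
  moreover have "parcs (star_graph d) \<subseteq> pverts (star_graph d) \<times> pverts (star_graph d)"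
    by (auto simp: star_graph_def)
  ultimately have "\<not> induced_free G (with_proj (star_graph d))"
    using not_induced_freeI[OF G] by metis
  then show False
    using free by simp
qed

lemma arcs_ends_induce_subgraph:
  "(u, v) \<in> arcs_ends (G \<restriction> B) \<longleftrightarrow> (u, v) \<in> arcs_ends G \<and> u \<in> B \<and> v \<in> B"
  unfolding arcs_ends_conv image_iff by (simp, blast)

text \<open>Each closed neighbourhood of an entry of \<open>P\<close> holds at most
  \<open>d - 1\<close> vertices of an independent set.\<close>

lemma independence_number_le:
  assumes G: "graph G" and free: "induced_free G (with_proj (star_graph d))" and "2 \<le> d"
    and B: "B \<subseteq> verts G" "B \<subseteq> closed_nbhd G (set P)"
  shows "independence_number (G \<restriction> B) \<le> (d - 1) * length P"
proof -
  interpret graph G by fact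
  have "card S \<le> (d - 1) * length P" if "independent_set (G \<restriction> B) S" for S
  proof -
    have "S \<subseteq> B"
      using that by (simp add: independent_set_def)
    moreover from this have "(u, v) \<notin> arcs_ends G" if "u \<in> S" "v \<in> S" for u v
      using that \<open>independent_set (G \<restriction> B) S\<close> arcs_ends_induce_subgraph
      unfolding independent_set_def by (metis subsetD)
    ultimately have S: "S \<subseteq> B" "independent_set G S"
      using B(1) by (simp_all add: independent_set_def)
    then have "S \<subseteq> (\<Union>v\<in>set P. S \<inter> closed_nbhd G {v})"
      using B(2) by (auto simp: closed_nbhd_def)
    moreover have "finite S"
      using finite_subset[OF subset_trans[OF S(1) B(1)]] by simp
    ultimately have "card S \<le> card (\<Union>v\<in>set P. S \<inter> closed_nbhd G {v})"
      by (intro card_mono) auto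
    also have "\<dots> \<le> (\<Sum>v\<in>set P. card (S \<inter> closed_nbhd G {v}))"
      by (rule card_UN_le) simp
    also have "\<dots> \<le> (\<Sum>v\<in>set P. d - 1)"
    proof (rule sum_mono)
      fix v
      show "card (S \<inter> closed_nbhd G {v}) \<le> d - 1"
        using S(2)
        by (intro card_independent_closed_nbhd_le[OF G free \<open>2 \<le> d\<close>]) (auto simp: independent_set_def)
    qed
    also have "\<dots> \<le> (d - 1) * length P"
      by (simp add: card_length mult.commute)
    finally show ?thesis .
  qed
  moreover have "finite {S. independent_set (G \<restriction> B) S}"
    using finite_subset[OF B(1)]
    by (intro finite_subset[of "{S. independent_set (G \<restriction> B) S}" "Pow B"])
      (simp_all add: independent_set_def Collect_mono Pow_def)
  moreover have "independent_set (G \<restriction> B) {}"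
    by (simp add: independent_set_def)
  ultimately show ?thesis
    unfolding independence_number_def by (intro Max.boundedI) auto
qed

section \<open>Induced paths\<close>

text \<open>The head of the list is the vertex added last, \<open>v\<^sub>k\<close> in the overview,
  so prolonging a path is a \<open>Cons\<close>. Only arcs from earlier to later entries are
  constrained; in a \<open>graph\<close>, symmetry settles the others.\<close>

fun induced_path :: "('a, 'b) pre_digraph \<Rightarrow> 'a list \<Rightarrow> bool" where
  "induced_path G [] \<longleftrightarrow> True"
| "induced_path G (v # vs) \<longleftrightarrow> v \<in> verts G \<and> v \<notin> set vs \<and> induced_path G vs \<and>
     (\<forall>i<length vs. (v, vs ! i) \<in> arcs_ends G \<longleftrightarrow> i = 0)"

lemma induced_path_distinct: "induced_path G vs \<Longrightarrow> distinct vs"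
  by (induction vs) auto

lemma induced_path_verts: "induced_path G vs \<Longrightarrow> set vs \<subseteq> verts G"
  by (induction vs) auto

lemma induced_path_nth:
  assumes "graph G"
  shows "induced_path G vs \<Longrightarrow> i < length vs \<Longrightarrow> j < length vs \<Longrightarrow>
    (vs ! i, vs ! j) \<in> arcs_ends G \<longleftrightarrow> i = Suc j \<or> j = Suc i"
proof (induction vs arbitrary: i j)
  case (Cons v vs)
  interpret graph G by fact
  have "(v, v) \<notin> arcs_ends G"
    using adj_not_same by blast
  moreover have "(vs ! k, v) \<in> arcs_ends G \<longleftrightarrow> k = 0" if "k < length vs" for k
    using Cons.prems(1) that arcs_ends_symmetric[OF sym_arcs] by auto
  ultimately show ?case
    using Cons by (cases i; cases j) auto
qed simp

text \<open>Indexing embeds \<open>path_graph s\<close> onto the first \<open>s\<close> vertices of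
  a path that is too long.\<close>

lemma induced_path_length_less:
  assumes G: "graph G" and free: "induced_free G (with_proj (path_graph s))"
    and vs: "induced_path G vs"
  shows "length vs < s"
proof (rule ccontr)
  assume "\<not> length vs < s"
  then have "s \<le> length vs"
    by simp
  then have "\<not> induced_free G (with_proj (path_graph s))"
    using induced_path_distinct[OF vs] induced_path_verts[OF vs] induced_path_nth[OF G vs]
    by (intro not_induced_freeI[OF G, where g = "(!) vs"])
      (auto simp: path_graph_def inj_on_def nth_eq_iff_index_eq)
  then show False
    using free by simp
qed

section \<open>Tree decompositions of the processed part\<close>

text \<open>A tree decomposition of the subgraph induced by \<open>U\<close>, with root node 0. In
  the last conjunct \<open>r\<close> is the topmost bag of \<open>v\<close>; this encodes the
  subtree condition in the form that \<open>undirected_tree_parent_tree\<close> needs.\<close>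

definition partial_decomposition ::
    "('a, 'b) pre_digraph \<Rightarrow> nat \<Rightarrow> (nat \<Rightarrow> nat) \<Rightarrow> (nat \<Rightarrow> 'a set) \<Rightarrow> 'a set \<Rightarrow> bool" where
  "partial_decomposition G n p \<beta> U \<longleftrightarrow> 0 < n \<and> (\<forall>i<n. 0 < i \<longrightarrow> p i < i) \<and>
     U \<subseteq> verts G \<and> (\<forall>i<n. \<beta> i \<subseteq> U) \<and>
     (\<forall>u\<in>U. \<forall>v\<in>U. (u, v) \<in> arcs_ends G \<longrightarrow> (\<exists>i<n. u \<in> \<beta> i \<and> v \<in> \<beta> i)) \<and>
     (\<forall>v\<in>U. \<exists>r<n. v \<in> \<beta> r \<and> (\<forall>i<n. v \<in> \<beta> i \<and> i \<noteq> r \<longrightarrow> p i < i \<and> v \<in> \<beta> (p i)))"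

text \<open>The empty bag makes the tree nonempty even if \<open>G\<close> has no vertices, and it
  is a node to which the first proper bag can be attached.\<close>

lemma partial_decomposition_empty:
  "partial_decomposition G 1 p (\<lambda>_. {}) {}"
  by (simp add: partial_decomposition_def)

text \<open>A vertex of \<open>N\<close> already lies in bag \<open>j\<close>, so its subtree gains
  the leaf \<open>n\<close>; a vertex of \<open>X\<close> has \<open>n\<close> as its only bag. A
  new edge has an end in \<open>X\<close>, so by the last assumption both ends lie in the new
  bag.\<close>

lemma partial_decomposition_extend:
  assumes G: "graph G" and part: "partial_decomposition G n p \<beta> U"
    and "j < n" "N \<subseteq> \<beta> j" and X: "X \<subseteq> verts G - U"
    and N: "\<And>x u. x \<in> X \<Longrightarrow> u \<in> U \<Longrightarrow> (x, u) \<in> arcs_ends G \<Longrightarrow> u \<in> N"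
  shows "partial_decomposition G (Suc n) (p(n := j)) (\<beta>(n := N \<union> X)) (U \<union> X)"
proof -
  interpret graph G by fact
  let ?p = "p(n := j)" and ?\<beta> = "\<beta>(n := N \<union> X)"
  have p: "i < n \<Longrightarrow> 0 < i \<Longrightarrow> p i < i" and "U \<subseteq> verts G" and \<beta>: "i < n \<Longrightarrow> \<beta> i \<subseteq> U"
    and edge: "u \<in> U \<Longrightarrow> v \<in> U \<Longrightarrow> (u, v) \<in> arcs_ends G \<Longrightarrow> \<exists>i<n. u \<in> \<beta> i \<and> v \<in> \<beta> i"
    and root: "v \<in> U \<Longrightarrow> \<exists>r<n. v \<in> \<beta> r \<and> (\<forall>i<n. v \<in> \<beta> i \<and> i \<noteq> r \<longrightarrow> p i < i \<and> v \<in> \<beta> (p i))"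
    for i u v
    using part unfolding partial_decomposition_def by auto
  have "N \<subseteq> U"
    using \<beta>[OF \<open>j < n\<close>] \<open>N \<subseteq> \<beta> j\<close> by blast
  have "\<exists>i<Suc n. u \<in> ?\<beta> i \<and> v \<in> ?\<beta> i"
    if uv: "u \<in> U \<union> X" "v \<in> U \<union> X" "(u, v) \<in> arcs_ends G" for u v
  proof (cases "u \<in> U \<and> v \<in> U")
    case True
    then obtain i where "i < n" "u \<in> \<beta> i" "v \<in> \<beta> i"
      using edge uv(3) by blast
    then show ?thesis
      by (intro exI[of _ i]) auto
  next
    case False
    moreover have "(v, u) \<in> arcs_ends G"
      using uv(3) arcs_ends_symmetric[OF sym_arcs] by blast
    ultimately have "u \<in> N \<union> X \<and> v \<in> N \<union> X"
      using uv N by blast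
    then show ?thesis
      by (intro exI[of _ n]) auto
  qed
  moreover have "\<exists>r<Suc n. v \<in> ?\<beta> r \<and> (\<forall>i<Suc n. v \<in> ?\<beta> i \<and> i \<noteq> r \<longrightarrow> ?p i < i \<and> v \<in> ?\<beta> (?p i))"
    if v: "v \<in> U \<union> X" for v
  proof (cases "v \<in> U")
    case True
    then obtain r where r: "r < n" "v \<in> \<beta> r"
        "\<forall>i<n. v \<in> \<beta> i \<and> i \<noteq> r \<longrightarrow> p i < i \<and> v \<in> \<beta> (p i)"
      using root by blast
    \<comment> \<open>So \<open>v\<close> can enter the new bag only through \<open>N\<close>, and
      then the parent bag \<open>j\<close> contains it.\<close>
    have "v \<notin> X"
      using True X by blast
    then show ?thesis
      using r \<open>j < n\<close> \<open>N \<subseteq> \<beta> j\<close> by (intro exI[of _ r]) (fastforce simp: less_Suc_eq)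
  next
    case False
    then have "v \<notin> \<beta> i" if "i < n" for i
      using \<beta> that by blast
    then show ?thesis
      using False v by (intro exI[of _ n]) (auto simp: less_Suc_eq)
  qed
  moreover have "\<forall>i<Suc n. ?\<beta> i \<subseteq> U \<union> X"
    using \<beta> \<open>N \<subseteq> U\<close> by (auto simp: less_Suc_eq)
  moreover have "\<forall>i<Suc n. 0 < i \<longrightarrow> ?p i < i"
    using p \<open>j < n\<close> by (auto simp: less_Suc_eq)
  moreover have "U \<union> X \<subseteq> verts G"
    using \<open>U \<subseteq> verts G\<close> X by blast
  ultimately show ?thesis
    unfolding partial_decomposition_def by (intro conjI ballI impI) (blast | simp)+
qed

lemma tree_decomposition_if_partial:
  assumes G: "graph G" and part: "partial_decomposition G n p \<beta> (verts G)"
  shows "tree_decomposition G (with_proj (parent_tree p {..<n})) \<beta>"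
proof -
  interpret graph G by fact
  let ?T = "with_proj (parent_tree p {..<n})"
  have n: "0 < n" and p: "i < n \<Longrightarrow> 0 < i \<Longrightarrow> p i < i" and \<beta>: "i < n \<Longrightarrow> \<beta> i \<subseteq> verts G"
    and edge: "u \<in> verts G \<Longrightarrow> v \<in> verts G \<Longrightarrow> (u, v) \<in> arcs_ends G \<Longrightarrow> \<exists>i<n. u \<in> \<beta> i \<and> v \<in> \<beta> i"
    and root: "v \<in> verts G \<Longrightarrow>
      \<exists>r<n. v \<in> \<beta> r \<and> (\<forall>i<n. v \<in> \<beta> i \<and> i \<noteq> r \<longrightarrow> p i < i \<and> v \<in> \<beta> (p i))"
    for i u v
    using part unfolding partial_decomposition_def by auto
  have "undirected_tree ?T"
    using n p by (intro undirected_tree_parent_tree[of _ 0]) fastforce+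
  moreover have "undirected_tree (?T \<restriction> {t \<in> verts ?T. v \<in> \<beta> t})" if v: "v \<in> verts G" for v
  proof -
    obtain r where r: "r < n" "v \<in> \<beta> r"
        "\<forall>i<n. v \<in> \<beta> i \<and> i \<noteq> r \<longrightarrow> p i < i \<and> v \<in> \<beta> (p i)"
      using root[OF v] by blast
    then have "undirected_tree (with_proj (parent_tree p {t \<in> verts ?T. v \<in> \<beta> t}))"
      by (intro undirected_tree_parent_tree[of _ r]) fastforce+
    then show ?thesis
      by (subst induce_subgraph_parent_tree) auto
  qed
  moreover have "\<exists>t\<in>verts ?T. tail G e \<in> \<beta> t \<and> head G e \<in> \<beta> t" if "e \<in> arcs G" for e
    using edge[of "tail G e" "head G e"] that by (auto simp: arcs_ends_conv)
  moreover have "\<exists>t\<in>verts ?T. v \<in> \<beta> t" if "v \<in> verts G" for v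
    using root[OF that] by auto
  ultimately show ?thesis
    unfolding tree_decomposition_def using \<beta> by simp
qed

section \<open>Components of \<open>G - U\<close> and their neighbours\<close>

text \<open>For a vertex \<open>x\<close> outside \<open>U\<close> this is the vertex set of its
  component in \<open>G - U\<close>; for \<open>x\<close> in \<open>U\<close> it is
  \<open>{x}\<close>.\<close>

definition component_avoiding :: "('a, 'b) pre_digraph \<Rightarrow> 'a set \<Rightarrow> 'a \<Rightarrow> 'a set" where
  "component_avoiding G U x =
     {y. (x, y) \<in> {(a, b). (a, b) \<in> arcs_ends G \<and> a \<notin> U \<and> b \<notin> U}\<^sup>*}"

text \<open>For a component \<open>C\<close> of \<open>G - U\<close> this is the whole of
  \<open>N(C)\<close>, as vertices outside both \<open>U\<close> and \<open>C\<close> are not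
  adjacent to \<open>C\<close>.\<close>

definition attachment :: "('a, 'b) pre_digraph \<Rightarrow> 'a set \<Rightarrow> 'a set \<Rightarrow> 'a set" where
  "attachment G U C = {u \<in> U. \<exists>c\<in>C. (c, u) \<in> arcs_ends G}"

lemma component_avoiding_self: "x \<in> component_avoiding G U x"
  by (simp add: component_avoiding_def)

lemma component_avoiding_step:
  "y \<in> component_avoiding G U x \<Longrightarrow> (y, z) \<in> arcs_ends G \<Longrightarrow> y \<notin> U \<Longrightarrow> z \<notin> U \<Longrightarrow>
    z \<in> component_avoiding G U x"
  unfolding component_avoiding_def by (auto intro: rtrancl_into_rtrancl)

lemma component_avoiding_disjoint:
  assumes "x \<notin> U" "y \<in> component_avoiding G U x"
  shows "y \<notin> U"
  using assms(2) unfolding component_avoiding_def mem_Collect_eq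
  by (cases rule: rtranclE) (use assms(1) in auto)

lemma component_avoiding_subset_verts:
  assumes "wf_digraph G" "x \<in> verts G"
  shows "component_avoiding G U x \<subseteq> verts G"
proof -
  interpret wf_digraph G by fact
  show ?thesis
  proof
    fix y assume "y \<in> component_avoiding G U x"
    then show "y \<in> verts G"
      unfolding component_avoiding_def mem_Collect_eq
      by (cases rule: rtranclE) (use assms(2) in auto)
  qed
qed

lemma component_avoiding_trans:
  "y \<in> component_avoiding G U x \<Longrightarrow> z \<in> component_avoiding G U y \<Longrightarrow>
    z \<in> component_avoiding G U x"
  unfolding component_avoiding_def by auto

lemma component_avoiding_sym:
  assumes "graph G" "y \<in> component_avoiding G U x"
  shows "x \<in> component_avoiding G U y"
proof -
  interpret graph G by fact
  have "sym ({(a, b). (a, b) \<in> arcs_ends G \<and> a \<notin> U \<and> b \<notin> U}\<^sup>*)"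
    using arcs_ends_symmetric[OF sym_arcs] by (intro sym_rtrancl) (auto simp: sym_def)
  then show ?thesis
    using assms(2) by (auto simp: component_avoiding_def dest: symD)
qed

lemma component_avoiding_antimono:
  "U \<subseteq> V \<Longrightarrow> component_avoiding G V x \<subseteq> component_avoiding G U x"
  unfolding component_avoiding_def
  by (intro Collect_mono impI, erule set_mp[OF rtrancl_mono, rotated]) auto

text \<open>Applied when \<open>X\<close> is the set of neighbours in a component of the first path vertex: every
  component that remains after removing \<open>X\<close> is attached to \<open>X\<close>, so the path can grow towards it.\<close>

lemma component_avoiding_hits:
  assumes "z \<in> component_avoiding G U y" "y \<notin> U" "y \<notin> X" "z \<in> X"
  obtains w where "w \<in> X" "w \<in> attachment G (U \<union> X) (component_avoiding G (U \<union> X) y)"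
proof -
  let ?D = "component_avoiding G (U \<union> X) y"
  \<comment> \<open>Along the walk from \<open>y\<close>, the first step out of \<open>?D\<close>
    stays outside \<open>U\<close> and hence enters \<open>X\<close>; its target is the required
    \<open>w\<close>. The walk must leave \<open>?D\<close>, since it ends in
    \<open>X\<close>.\<close>
  have "z \<in> ?D \<or> (\<exists>w\<in>X. w \<in> attachment G (U \<union> X) ?D)"
    using assms(1) unfolding component_avoiding_def[of G U y] mem_Collect_eq
  proof (induction rule: rtrancl_induct)
    case base
    then show ?case
      by (simp add: component_avoiding_self)
  next
    case (step z z')
    then show ?case
      using component_avoiding_step[of z G "U \<union> X" y z'] assms(2,3)
        component_avoiding_disjoint[of y "U \<union> X" z G]
      by (auto simp: attachment_def)
  qed
  then show ?thesis
    using that component_avoiding_disjoint[of y "U \<union> X" z G] assms(2-4) by (metis UnCI UnE)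
qed

text \<open>Walks from \<open>y\<close> avoiding \<open>U\<close> never meet the component of
  \<open>x\<close>, hence never meet \<open>X\<close>. A round spent on one component thus leaves
  the invariants of the others intact.\<close>

lemma component_avoiding_other:
  assumes G: "graph G" and X: "X \<subseteq> component_avoiding G U x" and y: "y \<notin> component_avoiding G U x"
    and "x \<notin> U" "y \<notin> U"
  shows "component_avoiding G (U \<union> X) y = component_avoiding G U y"
    and "attachment G (U \<union> X) (component_avoiding G U y) = attachment G U (component_avoiding G U y)"
proof -
  have disj: "z \<notin> component_avoiding G U x" if "z \<in> component_avoiding G U y" for z
    using y component_avoiding_trans[OF _ component_avoiding_sym[OF G that]] by blast
  have "z \<in> component_avoiding G (U \<union> X) y" if "z \<in> component_avoiding G U y" for z
    using that unfolding component_avoiding_def[of G U y] mem_Collect_eq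
  proof (induction rule: rtrancl_induct)
    case base
    then show ?case
      by (simp add: component_avoiding_self)
  next
    case (step z z')
    then have "z \<in> component_avoiding G U y" "z' \<in> component_avoiding G U y"
      unfolding component_avoiding_def by (auto intro: rtrancl_into_rtrancl)
    then have "z \<notin> X" "z' \<notin> X"
      using disj X by blast+
    then show ?case
      using step component_avoiding_step[of z G "U \<union> X" y z'] by simp
  qed
  then show "component_avoiding G (U \<union> X) y = component_avoiding G U y"
    using component_avoiding_antimono[of U "U \<union> X" G y] by blast
  have "(c, u) \<notin> arcs_ends G" if "u \<in> X" "c \<in> component_avoiding G U y" for c u
  proof
    assume "(c, u) \<in> arcs_ends G"
    moreover have "u \<notin> U" "c \<notin> U"
      using component_avoiding_disjoint[OF \<open>x \<notin> U\<close>] component_avoiding_disjoint[OF \<open>y \<notin> U\<close>] that X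
      by blast+
    ultimately have "u \<in> component_avoiding G U y"
      using component_avoiding_step that(2) by metis
    then show False
      using disj that(1) X by blast
  qed
  then show "attachment G (U \<union> X) (component_avoiding G U y) = attachment G U (component_avoiding G U y)"
    by (auto simp: attachment_def)
qed

section \<open>One round of the search\<close>

text \<open>The state of the search for a component \<open>C\<close> of \<open>G - U\<close>: its attachment is dominated by an
  induced path in \<open>G\<close> of which only the first vertex \<open>v\<close> has neighbours in \<open>C\<close>, so that the path can
  be prolonged by any neighbour of \<open>v\<close> in \<open>C\<close>.\<close>

definition guarded :: "('a, 'b) pre_digraph \<Rightarrow> 'a set \<Rightarrow> 'a set \<Rightarrow> bool" where
  "guarded G U C \<longleftrightarrow> attachment G U C = {} \<or>
     (\<exists>v vs. induced_path G (v # vs) \<and> v \<in> attachment G U C \<and>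
        attachment G U C \<subseteq> closed_nbhd G (set (v # vs)) \<and> C \<inter> closed_nbhd G (set vs) = {})"

lemma induced_path_extend:
  assumes G: "graph G" and path: "induced_path G (v # vs)" and "(w, v) \<in> arcs_ends G"
    and w: "w \<notin> closed_nbhd G (set vs)"
  shows "induced_path G (w # v # vs)"
proof -
  interpret graph G by fact
  have "w \<in> verts G" "w \<noteq> v"
    using \<open>(w, v) \<in> arcs_ends G\<close> adj_not_same by auto
  moreover have "w \<notin> set vs"
    using w by (simp add: closed_nbhd_def)
  moreover have "(w, u) \<notin> arcs_ends G" if "u \<in> set vs" for u
    using w that arcs_ends_symmetric[OF sym_arcs, of w u] by (auto simp: closed_nbhd_def)
  ultimately show ?thesis
    using path \<open>(w, v) \<in> arcs_ends G\<close> by (simp add: nth_Cons split: nat.split)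
qed

text \<open>Without attachment, \<open>P\<close> is \<open>[x]\<close> and \<open>X\<close> is
  \<open>{x}\<close>. Otherwise \<open>P\<close> is the guarding path and \<open>X\<close> consists
  of the neighbours of its head in \<open>C\<close>. The next bag will be
  \<open>attachment G U C \<union> X\<close>.\<close>

lemma guarded_step:
  assumes G: "graph G" and "1 \<le> k"
    and short: "\<And>vs. induced_path G vs \<Longrightarrow> length vs \<le> Suc k"
    and x: "x \<in> verts G" "x \<notin> U"
    and C: "C = component_avoiding G U x" and guarded: "guarded G U C"
  obtains P X where "length P \<le> k" "attachment G U C \<union> X \<subseteq> closed_nbhd G (set P)"
    "X \<noteq> {}" "X \<subseteq> C"
    "\<And>y. y \<in> C \<Longrightarrow> y \<notin> X \<Longrightarrow> guarded G (U \<union> X) (component_avoiding G (U \<union> X) y)"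
proof -
  interpret graph G by fact
  have "x \<in> C"
    by (simp add: C component_avoiding_self)
  have C_U: "c \<notin> U" if "c \<in> C" for c
    using that component_avoiding_disjoint[OF x(2)] by (simp add: C)
  have sub_C: "component_avoiding G (U \<union> X) y \<subseteq> C" if "y \<in> C" for X y
    using component_avoiding_antimono[of U "U \<union> X" G y] component_avoiding_trans[of y G U x] that
    unfolding C by blast
  have att: "attachment G (U \<union> X) (component_avoiding G (U \<union> X) y) \<subseteq> attachment G U C \<union> X"
    if "y \<in> C" for X y
    using sub_C[OF that, of X] unfolding attachment_def by blast
  show ?thesis
  proof (cases "attachment G U C = {}")
    case True
    show ?thesis
    proof (rule that[of "[x]" "{x}"])
      \<comment> \<open>A component left over in \<open>C\<close> can be attached only to
        \<open>x\<close>; if it is, the one-vertex path \<open>[x]\<close> guards it.\<close>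
      fix y assume "y \<in> C" "y \<notin> {x}"
      let ?A = "attachment G (U \<union> {x}) (component_avoiding G (U \<union> {x}) y)"
      have "?A \<subseteq> {x}"
        using att[OF \<open>y \<in> C\<close>, of "{x}"] True by simp
      moreover have "{x} \<subseteq> closed_nbhd G (set [x])"
        by (simp add: closed_nbhd_def)
      moreover have "induced_path G [x]" "closed_nbhd G (set []) = {}"
        using x(1) by (simp_all add: closed_nbhd_def)
      ultimately show "guarded G (U \<union> {x}) (component_avoiding G (U \<union> {x}) y)"
        unfolding guarded_def by blast
    qed (use \<open>x \<in> C\<close> \<open>1 \<le> k\<close> True in \<open>auto simp: closed_nbhd_def\<close>)
  next
    case False
    then obtain v vs where path: "induced_path G (v # vs)" and v: "v \<in> attachment G U C"
      and dom: "attachment G U C \<subseteq> closed_nbhd G (set (v # vs))"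
      and avoid: "C \<inter> closed_nbhd G (set vs) = {}"
      using guarded unfolding guarded_def by blast
    have "v \<in> U"
      using v by (simp add: attachment_def)
    define X where "X = {c \<in> C. (c, v) \<in> arcs_ends G}"
    obtain c where "c \<in> X"
      using v unfolding X_def attachment_def by blast
    have extend: "induced_path G (w # v # vs)" if "w \<in> X" for w
      using that avoid by (intro induced_path_extend[OF G path]) (auto simp: X_def)
    have X_nbhd: "X \<subseteq> closed_nbhd G {v}"
      using arcs_ends_symmetric[OF sym_arcs] by (auto simp: X_def closed_nbhd_def)
    have nbhd_Cons: "closed_nbhd G (set (u # us)) = closed_nbhd G {u} \<union> closed_nbhd G (set us)" for u us
      by (auto simp: closed_nbhd_def)
    show ?thesis
    proof (rule that[of "v # vs" X])
      \<comment> \<open>The bound \<open>Suc k\<close> applies to the path prolonged by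
        \<open>c\<close>, which leaves at most \<open>k\<close> vertices without
        \<open>c\<close>.\<close>
      show "length (v # vs) \<le> k"
        using short[OF extend[OF \<open>c \<in> X\<close>]] by simp
      show "attachment G U C \<union> X \<subseteq> closed_nbhd G (set (v # vs))"
        using dom X_nbhd unfolding nbhd_Cons by blast
      show "X \<noteq> {}" "X \<subseteq> C"
        using \<open>c \<in> X\<close> by (auto simp: X_def)
      fix y assume y: "y \<in> C" "y \<notin> X"
      let ?D = "component_avoiding G (U \<union> X) y"
      \<comment> \<open>As \<open>c\<close> and \<open>y\<close> share the component
        \<open>C\<close>, \<open>component_avoiding_hits\<close> yields the vertex \<open>w\<close>
        that becomes the new head of the path.\<close>
      have "c \<in> component_avoiding G U y"
        using component_avoiding_trans[OF component_avoiding_sym[OF G]] y(1) \<open>c \<in> X\<close>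
        unfolding C X_def by blast
      then obtain w where w: "w \<in> X" "w \<in> attachment G (U \<union> X) ?D"
        using component_avoiding_hits C_U[OF y(1)] y(2) \<open>c \<in> X\<close> by metis
      \<comment> \<open>All of \<open>?D\<close> lies in \<open>C\<close> but outside
        \<open>X\<close>, hence is not adjacent to the old head \<open>v\<close>, which may now join
        the tail.\<close>
      have "e \<notin> closed_nbhd G (set (v # vs))" if "e \<in> ?D" for e
      proof -
        have "e \<in> C" "e \<notin> X"
          using sub_C[OF y(1)] component_avoiding_disjoint[OF _ that] C_U[OF y(1)] y(2) that by blast+
        then have "e \<noteq> v" "(v, e) \<notin> arcs_ends G"
          using C_U[of e] \<open>v \<in> U\<close> arcs_ends_symmetric[OF sym_arcs, of v e] by (auto simp: X_def)
        then have "e \<notin> closed_nbhd G {v}"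
          by (simp add: closed_nbhd_def)
        then show ?thesis
          using \<open>e \<in> C\<close> avoid unfolding nbhd_Cons by blast
      qed
      moreover have "attachment G (U \<union> X) ?D \<subseteq> closed_nbhd G (set (w # v # vs))"
        using att[OF y(1), of X] dom X_nbhd unfolding nbhd_Cons[of w] nbhd_Cons[of v] by blast
      ultimately show "guarded G (U \<union> X) ?D"
        using extend[OF w(1)] w(2) unfolding guarded_def by blast
    qed
  qed
qed

section \<open>Processing all vertices, and the bound\<close>

text \<open>Induction on the number of unprocessed vertices, which drops because \<open>X\<close> is
  nonempty. Invariants: every bag lies in at most \<open>k\<close> closed neighbourhoods; every
  remaining component is guarded and has its attachment inside one bag, below which its next bag is
  hung.\<close>

lemma partial_decomposition_complete:
  assumes G: "graph G" and "1 \<le> k"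
    and short: "\<And>vs. induced_path G vs \<Longrightarrow> length vs \<le> Suc k"
    and part: "partial_decomposition G n p \<beta> U"
    and bags: "\<And>i. i < n \<Longrightarrow> \<exists>P. \<beta> i \<subseteq> closed_nbhd G (set P) \<and> length P \<le> k"
    and att: "\<And>x. x \<in> verts G - U \<Longrightarrow>
      \<exists>j<n. attachment G U (component_avoiding G U x) \<subseteq> \<beta> j"
    and paths: "\<And>x. x \<in> verts G - U \<Longrightarrow> guarded G U (component_avoiding G U x)"
  shows "\<exists>n p \<beta>. partial_decomposition G n p \<beta> (verts G) \<and>
    (\<forall>i<n. \<exists>P. \<beta> i \<subseteq> closed_nbhd G (set P) \<and> length P \<le> k)"
  using part bags att paths
proof (induction "card (verts G - U)" arbitrary: n p \<beta> U rule: less_induct)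
  case less
  interpret graph G by fact
  have "U \<subseteq> verts G"
    using less.prems(1) by (simp add: partial_decomposition_def)
  show ?case
  proof (cases "U = verts G")
    case True
    then show ?thesis
      using less.prems by blast
  next
    case False
    then obtain x where x: "x \<in> verts G" "x \<notin> U"
      using \<open>U \<subseteq> verts G\<close> by blast
    define C where "C = component_avoiding G U x"
    define N where "N = attachment G U C"
    have "C \<subseteq> verts G"
      unfolding C_def using component_avoiding_subset_verts[OF wf_digraph x(1)] .
    have C_U: "c \<notin> U" if "c \<in> C" for c
      using that component_avoiding_disjoint[OF x(2)] by (simp add: C_def)
    obtain j where j: "j < n" "N \<subseteq> \<beta> j"
      using less.prems(3)[of x] x by (auto simp: N_def C_def)
    have "guarded G U C"
      using less.prems(4)[of x] x by (simp add: C_def)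
    obtain P X where P: "length P \<le> k" "N \<union> X \<subseteq> closed_nbhd G (set P)"
      and X: "X \<noteq> {}" "X \<subseteq> C"
      and step: "\<And>y. y \<in> C \<Longrightarrow> y \<notin> X \<Longrightarrow> guarded G (U \<union> X) (component_avoiding G (U \<union> X) y)"
      by (rule guarded_step[OF G \<open>1 \<le> k\<close> short x C_def \<open>guarded G U C\<close>, folded N_def]) (assumption, rule that, assumption+)
    let ?p = "p(n := j)" and ?\<beta> = "\<beta>(n := N \<union> X)"
    have X_U: "X \<subseteq> verts G - U"
      using X(2) \<open>C \<subseteq> verts G\<close> C_U by blast
    \<comment> \<open>The new bag \<open>n\<close> contains the attachment of every component into
      which \<open>C\<close> breaks up, so it can serve as parent for their bags.\<close>
    have sub: "attachment G (U \<union> X) (component_avoiding G (U \<union> X) y) \<subseteq> N \<union> X" if "y \<in> C" for y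
    proof -
      have "component_avoiding G (U \<union> X) y \<subseteq> C"
        using component_avoiding_antimono[of U "U \<union> X" G y] component_avoiding_trans[of y G U x] that
        unfolding C_def by blast
      then show ?thesis
        unfolding attachment_def N_def by blast
    qed
    have other: "component_avoiding G (U \<union> X) y = component_avoiding G U y"
        "attachment G (U \<union> X) (component_avoiding G U y) = attachment G U (component_avoiding G U y)"
      if "y \<notin> C" "y \<notin> U" for y
      using component_avoiding_other[OF G X(2)[unfolded C_def]] that x(2) by (simp_all add: C_def)
    have less_card: "card (verts G - (U \<union> X)) < card (verts G - U)"
      using X(1) X_U by (intro psubset_card_mono) auto
    have part': "partial_decomposition G (Suc n) ?p ?\<beta> (U \<union> X)"
    proof (rule partial_decomposition_extend[OF G less.prems(1) j X_U])
      fix a u assume "a \<in> X" "u \<in> U" "(a, u) \<in> arcs_ends G"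
      then show "u \<in> N"
        using X(2) unfolding N_def attachment_def by blast
    qed
    show ?thesis
    proof (rule less.hyps[OF less_card part'])
      fix i assume "i < Suc n"
      then show "\<exists>P. ?\<beta> i \<subseteq> closed_nbhd G (set P) \<and> length P \<le> k"
        using P less.prems(2)[of i] by (cases "i = n") auto
    next
      fix y assume y: "y \<in> verts G - (U \<union> X)"
      show "\<exists>i<Suc n. attachment G (U \<union> X) (component_avoiding G (U \<union> X) y) \<subseteq> ?\<beta> i"
      proof (cases "y \<in> C")
        case True
        then show ?thesis
          using sub by (intro exI[of _ n]) simp
      next
        case False
        moreover obtain i where "i < n" "attachment G U (component_avoiding G U y) \<subseteq> \<beta> i"
          using less.prems(3)[of y] y by blast
        ultimately show ?thesis
          using other[of y] y by (intro exI[of _ i]) simp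
      qed
      show "guarded G (U \<union> X) (component_avoiding G (U \<union> X) y)"
      proof (cases "y \<in> C")
        case True
        then show ?thesis
          using step y by blast
      next
        case False
        then show ?thesis
          using other[of y] y less.prems(4)[of y] by (simp add: guarded_def)
      qed
    qed
  qed
qed

theorem theorem1p5:
  fixes G :: "('a, 'b) pre_digraph" and d s :: nat
  assumes "2 \<le> d" and "3 \<le> s"
    and "graph G"
    and "induced_free G (with_proj (star_graph d))"
    and "induced_free G (with_proj (path_graph s))"
  shows "tree_alpha G \<le> (d - 1) * (s - 2)"
proof -
  \<comment> \<open>Here \<open>k\<close> is \<open>s - 2\<close>: an induced path has at most
    \<open>s - 1\<close> vertices, one more than a guarding path may have.\<close>
  have short: "length vs \<le> Suc (s - 2)" if "induced_path G vs" for vs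
    using induced_path_length_less[OF assms(3,5) that] by simp
  have no_attachment: "attachment G {} C = {}" for C
    by (simp add: attachment_def)
  have "\<exists>n p \<beta>. partial_decomposition G n p \<beta> (verts G) \<and>
      (\<forall>i<n. \<exists>P. \<beta> i \<subseteq> closed_nbhd G (set P) \<and> length P \<le> s - 2)"
    \<comment> \<open>At the start \<open>U\<close> is empty, so nothing is attached; the single
      empty bag is covered by the empty list.\<close>
    by (rule partial_decomposition_complete[OF assms(3) _ short partial_decomposition_empty])
      (use assms(2) no_attachment in \<open>auto simp: guarded_def intro: exI[of _ "[]"]\<close>)
  then obtain n p \<beta> where part: "partial_decomposition G n p \<beta> (verts G)"
    and bags: "\<And>i. i < n \<Longrightarrow> \<exists>P. \<beta> i \<subseteq> closed_nbhd G (set P) \<and> length P \<le> s - 2"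
    by blast
  let ?T = "with_proj (parent_tree p {..<n})"
  have td: "tree_decomposition G ?T \<beta>"
    by (rule tree_decomposition_if_partial[OF assms(3) part])
  have "independence_number (G \<restriction> \<beta> t) \<le> (d - 1) * (s - 2)" if "t < n" for t
  proof -
    obtain P where P: "\<beta> t \<subseteq> closed_nbhd G (set P)" "length P \<le> s - 2"
      using bags[OF \<open>t < n\<close>] by blast
    have "\<beta> t \<subseteq> verts G"
      using part that by (simp add: partial_decomposition_def)
    then have "independence_number (G \<restriction> \<beta> t) \<le> (d - 1) * length P"
      using independence_number_le[OF assms(3,4,1)] P(1) by blast
    also have "\<dots> \<le> (d - 1) * (s - 2)"
      using P(2) by simp
    finally show ?thesis .
  qed
  moreover have "0 < n"
    using part by (simp add: partial_decomposition_def)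
  ultimately have "decomposition_independence_number G ?T \<beta> \<le> (d - 1) * (s - 2)"
    unfolding decomposition_independence_number_def by (intro Max.boundedI) auto
  moreover have "tree_alpha G \<le> decomposition_independence_number G ?T \<beta>"
    unfolding tree_alpha_def using td by (intro Least_le) blast
  ultimately show ?thesis
    by simp
qed

end
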